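(* Let $\mathcal L=\{L_1,\dots,L_s\}$ be $s\ge3$ distinct skew lines in $\mathbb P^3_K$, $K$ a field. Let $Z$ be a nonempty subset of $\bigcup_iL_i$. The following are equivalent: (a) $Z$ is collinearly complete with respect to $\mathcal L$; (b) $Z$ is a union of orbits for $\mathcal L$. Let $p\in\bigcup_iL_i$ and let $1\le j<k\le s$. We have moreover: (1) If $1\le j,k,l\le s$ are distinct, then $f_{jkl}([p]_j)=[p]_k$, hence $|[p]_j|=|[p]_k|$. (2) All orbits $[p]$ are finite if and only if $G_i$ is finite for some $i$ (or equivalently, every $i$). (3) If $Z$ is collinearly complete with respect to $\mathcal L$, then $|Z\cap L_j|=|Z\cap L_k|$.
   Context: For distinct $i,j,k$ let $f_{ijk}\colon L_i\to L_j$ be the linear isomorphism sending $p\in L_i$ to the point where the plane spanned by $p$ and $L_k$ meets $L_j$. The groupoid $C_{\mathcal L}$ has the lines $L_i$ as objects and all possible compositions of the maps $f_{ijk}$ as arrows. Put $G_i=\mathrm{Hom}_{C_{\mathcal L}}(L_i,L_i)$. For $p\in L_i$, its orbit is $[p]=\bigcup_j\{g(p):g\in\mathrm{Hom}_{C_{\mathcal L}}(L_i,L_j)\}$, and $[p]_j=[p]\cap L_j$. A nonempty (possibly infinite) subset $Z\subseteq\bigcup_iL_i$ is collinearly complete with respect to $\mathcal L$ if whenever $T$ is a transversal for 3 or more of the lines $L_i$ (i.e. a line, not one of the $L_i$, that meets at least three of them) such that $T\cap Z\ne\varnothing$, then $T\cap(\bigcup_iL_i)\subseteq Z$. *)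

theory Defs
  imports "HOL-Analysis.Cartesian_Space" "HOL-Library.Equipollence" "HOL-Library.FuncSet"
begin

text \<open>
  Points of the projective 3-space over \<open>'a\<close> are the one-dimensional subspaces of \<open>'a ^ 4\<close>;
  lines, and linear spans in general, are sets of such points.
\<close>

type_synonym 'a ppoint = "('a ^ 4) set"

definition proj_points :: "'a::field ppoint set" where
  "proj_points = {p. vec.subspace p \<and> vec.dim p = 1}"

definition proj_line :: "'a::field ppoint set \<Rightarrow> bool" where
  "proj_line T \<longleftrightarrow>
     (\<exists>W. vec.subspace W \<and> vec.dim W = 2 \<and> T = {p \<in> proj_points. p \<subseteq> W})"

definition proj_span :: "'a::field ppoint set \<Rightarrow> 'a ppoint set" where
  "proj_span S = {p \<in> proj_points. p \<subseteq> vec.span (\<Union>S)}"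

definition skew :: "'a::field ppoint set \<Rightarrow> 'a ppoint set \<Rightarrow> bool" where
  "skew T U \<longleftrightarrow> T \<inter> U = {}"

definition skew_lines :: "(nat \<Rightarrow> 'a::field ppoint set) \<Rightarrow> nat \<Rightarrow> bool" where
  "skew_lines L s \<longleftrightarrow>
     (\<forall>i\<in>{1..s}. proj_line (L i)) \<and>
     (\<forall>i\<in>{1..s}. \<forall>j\<in>{1..s}. i \<noteq> j \<longrightarrow> L i \<noteq> L j \<and> skew (L i) (L j))"

definition union_lines :: "(nat \<Rightarrow> 'a::field ppoint set) \<Rightarrow> nat \<Rightarrow> 'a ppoint set" where
  "union_lines L s = (\<Union>i\<in>{1..s}. L i)"

text \<open>
  For pairwise skew \<open>L i\<close>, \<open>L j\<close>, \<open>L k\<close> and \<open>p \<in> L i\<close>, the span of \<open>p\<close> and \<open>L k\<close> is a plane that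
  does not contain \<open>L j\<close>, so it meets \<open>L j\<close> in exactly one point. All maps between lines are
  extensional (\<open>undefined\<close> off their source line), so that two arrows are equal iff they agree
  as maps on the source line; finiteness of a Hom-set therefore has its intended meaning.
\<close>

definition line_map ::
  "(nat \<Rightarrow> 'a::field ppoint set) \<Rightarrow> nat \<Rightarrow> nat \<Rightarrow> nat \<Rightarrow> 'a ppoint \<Rightarrow> 'a ppoint" where
  "line_map L i j k = (\<lambda>p\<in>L i. THE q. q \<in> proj_span (insert p (L k)) \<inter> L j)"

inductive is_arrow ::
  "(nat \<Rightarrow> 'a::field ppoint set) \<Rightarrow> nat \<Rightarrow> nat \<Rightarrow> nat \<Rightarrow> ('a ppoint \<Rightarrow> 'a ppoint) \<Rightarrow> bool"
  for L s where
  identity: "i \<in> {1..s} \<Longrightarrow> is_arrow L s i i (\<lambda>p\<in>L i. p)"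
| generator: "\<lbrakk>i \<in> {1..s}; j \<in> {1..s}; k \<in> {1..s}; i \<noteq> j; i \<noteq> k; j \<noteq> k\<rbrakk>
    \<Longrightarrow> is_arrow L s i j (line_map L i j k)"
| composition: "\<lbrakk>is_arrow L s i j g; is_arrow L s j k h\<rbrakk>
    \<Longrightarrow> is_arrow L s i k (compose (L i) h g)"

definition Hom ::
  "(nat \<Rightarrow> 'a::field ppoint set) \<Rightarrow> nat \<Rightarrow> nat \<Rightarrow> nat \<Rightarrow> ('a ppoint \<Rightarrow> 'a ppoint) set" where
  "Hom L s i j = {g. is_arrow L s i j g}"

definition vertex_group ::
  "(nat \<Rightarrow> 'a::field ppoint set) \<Rightarrow> nat \<Rightarrow> nat \<Rightarrow> ('a ppoint \<Rightarrow> 'a ppoint) set" where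
  "vertex_group L s i = Hom L s i i"

text \<open>For pairwise disjoint lines, the index \<open>i\<close> with \<open>p \<in> L i\<close> is unique.\<close>

definition orbit :: "(nat \<Rightarrow> 'a::field ppoint set) \<Rightarrow> nat \<Rightarrow> 'a ppoint \<Rightarrow> 'a ppoint set" where
  "orbit L s p = (\<Union>i\<in>{i \<in> {1..s}. p \<in> L i}. \<Union>j\<in>{1..s}. {g p | g. g \<in> Hom L s i j})"

definition orbit_on ::
  "(nat \<Rightarrow> 'a::field ppoint set) \<Rightarrow> nat \<Rightarrow> 'a ppoint \<Rightarrow> nat \<Rightarrow> 'a ppoint set" where
  "orbit_on L s p j = orbit L s p \<inter> L j"

definition transversal3 ::
  "(nat \<Rightarrow> 'a::field ppoint set) \<Rightarrow> nat \<Rightarrow> 'a ppoint set \<Rightarrow> bool" where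
  "transversal3 L s T \<longleftrightarrow>
     proj_line T \<and> (\<forall>i\<in>{1..s}. T \<noteq> L i) \<and> card {i \<in> {1..s}. T \<inter> L i \<noteq> {}} \<ge> 3"

definition collinearly_complete ::
  "(nat \<Rightarrow> 'a::field ppoint set) \<Rightarrow> nat \<Rightarrow> 'a ppoint set \<Rightarrow> bool" where
  "collinearly_complete L s Z \<longleftrightarrow>
     Z \<noteq> {} \<and> Z \<subseteq> union_lines L s \<and>
     (\<forall>T. transversal3 L s T \<and> T \<inter> Z \<noteq> {} \<longrightarrow> T \<inter> union_lines L s \<subseteq> Z)"

definition union_of_orbits ::
  "(nat \<Rightarrow> 'a::field ppoint set) \<Rightarrow> nat \<Rightarrow> 'a ppoint set \<Rightarrow> bool" where
  "union_of_orbits L s Z \<longleftrightarrow> (\<exists>P \<subseteq> union_lines L s. Z = (\<Union>p\<in>P. orbit L s p))"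

end

theory Submission
  imports Defs
begin

text \<open>
  Lift each line to a plane \<open>W i\<close> in \<open>K ^ 4\<close>. The map \<open>f\<^bsub>ijk\<^esub>\<close> is induced by the linear projection onto
  \<open>W j\<close> along \<open>W k\<close>, its inverse is \<open>f\<^bsub>jik\<^esub>\<close>, and \<open>q = f\<^bsub>ijk\<^esub>(p)\<close> holds iff some line through \<open>p\<close> and \<open>q\<close> meets
  \<open>L k\<close>. Hence collinear completeness and being a union of orbits both mean being closed under the
  generators of the groupoid. For (2), an element of \<open>G\<^sub>i\<close> is a projective linear map, so it is
  determined by its values at three points of \<open>L i\<close>, which lie in three finite orbits; conversely all
  Hom-sets embed in any single vertex group because the groupoid is connected.
\<close>

section \<open>Points and lines of projective space through spans of one and two vectors\<close>

lemma span_singleton_iff: "x \<in> vec.span {v::'a::field^'n} \<longleftrightarrow> (\<exists>c. x = c *s v)"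
  by (auto simp: vec.span_singleton)

lemma span_pair_iff: "x \<in> vec.span {v, w::'a::field^'n} \<longleftrightarrow> (\<exists>a b. x = a *s v + b *s w)"
proof -
  have "x \<in> vec.span {v, w} \<longleftrightarrow> (\<exists>a b. x - a *s v = b *s w)"
    by (simp add: vec.span_breakdown_eq[of x v] span_singleton_iff)
  also have "\<dots> \<longleftrightarrow> (\<exists>a b. x = a *s v + b *s w)"
    by (simp add: diff_eq_eq add.commute)
  finally show ?thesis .
qed

lemma span_scale_eq:
  assumes "c \<noteq> 0" shows "vec.span {c *s v} = vec.span {v::'a::field^'n}"
proof (rule subset_antisym)
  show "vec.span {c *s v} \<subseteq> vec.span {v}"
    by (auto simp: span_singleton_iff)
  have "k *s v = (k / c) *s (c *s v)" for k
    using assms by simp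
  then show "vec.span {v} \<subseteq> vec.span {c *s v}"
    by (metis span_singleton_iff subsetI)
qed

lemma span_eqE:
  assumes "vec.span {v} = vec.span {w::'a::field^'n}"
  obtains c where "v = c *s w"
  using assms by (metis span_singleton_iff vec.span_base singletonI)

lemma span_in_proj_points: "v \<noteq> 0 \<Longrightarrow> vec.span {v} \<in> proj_points"
  by (simp add: proj_points_def)

lemma proj_pointsE:
  assumes "p \<in> proj_points"
  obtains v where "v \<noteq> 0" "p = vec.span {v}"
proof -
  have p: "vec.subspace p" "vec.dim p = 1"
    using assms by (auto simp: proj_points_def)
  obtain B where B: "B \<subseteq> p" "vec.independent B" "p \<subseteq> vec.span B" "card B = 1"
    using vec.basis_exists[of p] p by metis
  then obtain v where v: "B = {v}"
    using card_1_singletonE by blast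
  have "v \<noteq> 0"
    using B v vec.dependent_zero by blast
  moreover have "p = vec.span {v}"
    using B v p by (metis subset_antisym vec.span_minimal)
  ultimately show thesis
    using that by blast
qed

lemma span_singleton_subset_iff:
  "vec.subspace W \<Longrightarrow> vec.span {v} \<subseteq> W \<longleftrightarrow> v \<in> W"
  by (meson singletonI subset_iff vec.span_base vec.span_minimal empty_subsetI insert_subset)

lemma dim_span_pair:
  assumes "v \<noteq> 0" "w \<notin> vec.span {v}"
  shows "vec.dim (vec.span {w, v}) = 2"
  using assms by (simp add: vec.dim_insert)

lemma plane_eq_span_pair:
  assumes "vec.subspace W" "vec.dim W = 2" "v \<in> W" "w \<in> W" "v \<noteq> 0" "w \<notin> vec.span {v}"
  shows "W = vec.span {w, v}"
proof (rule sym, rule vec.subspace_dim_equal)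
  show "vec.span {w, v} \<subseteq> W"
    using assms by (simp add: vec.span_minimal)
  show "vec.dim W \<le> vec.dim (vec.span {w, v})"
    using dim_span_pair[OF assms(5,6)] assms by linarith
qed (use assms in auto)

lemma plane_basisE:
  assumes "vec.subspace W" "vec.dim W = 2"
  obtains v w where "v \<in> W" "w \<in> W" "v \<noteq> 0" "w \<notin> vec.span {v}"
proof -
  have "\<not> W \<subseteq> {0}"
    using vec.dim_le_card[of W "{}"] assms by auto
  then obtain v where v: "v \<in> W" "v \<noteq> 0" by auto
  have "\<not> W \<subseteq> vec.span {v}"
    using vec.dim_le_card[of W "{v}"] assms by auto
  then show thesis
    using v that by blast
qed

text \<open>Representatives of two distinct points are linearly independent, so they span both
  underlying planes.\<close>

lemma proj_line_eqI:
  assumes "proj_line T" "proj_line U" "p \<in> T" "p \<in> U" "q \<in> T" "q \<in> U" "p \<noteq> q"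
  shows "T = U"
proof -
  obtain A where A: "vec.subspace A" "vec.dim A = 2" "T = {p \<in> proj_points. p \<subseteq> A}"
    using assms(1) unfolding proj_line_def by blast
  obtain B where B: "vec.subspace B" "vec.dim B = 2" "U = {p \<in> proj_points. p \<subseteq> B}"
    using assms(2) unfolding proj_line_def by blast
  obtain v where v: "v \<noteq> 0" "p = vec.span {v}"
    using assms(3) A proj_pointsE[of p thesis] by blast
  obtain w where w: "w \<noteq> 0" "q = vec.span {w}"
    using assms(5) A proj_pointsE[of q thesis] by blast
  have "w \<notin> vec.span {v}"
  proof
    assume "w \<in> vec.span {v}"
    then obtain c where "w = c *s v" by (auto simp: span_singleton_iff)
    with w v assms(7) show False
      by (cases "c = 0") (auto simp: span_scale_eq)
  qed
  moreover have "v \<in> A" "w \<in> A" "v \<in> B" "w \<in> B"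
    using A B v w assms by (auto simp: span_singleton_subset_iff)
  ultimately have "A = vec.span {w, v}" "B = vec.span {w, v}"
    using plane_eq_span_pair[OF A(1,2)] plane_eq_span_pair[OF B(1,2)] v(1) by blast+
  then show ?thesis using A B by simp
qed

section \<open>Skew lines as planes in \<open>K ^ 4\<close>, and the projections between these
  planes\<close>

locale skew_config =
  fixes L :: "nat \<Rightarrow> 'a::field ppoint set" and W :: "nat \<Rightarrow> ('a^4) set" and s :: nat
  assumes subspace_W: "i \<in> {1..s} \<Longrightarrow> vec.subspace (W i)"
    and dim_W: "i \<in> {1..s} \<Longrightarrow> vec.dim (W i) = 2"
    and L_eq: "i \<in> {1..s} \<Longrightarrow> L i = {p \<in> proj_points. p \<subseteq> W i}"
    and W_Int: "i \<in> {1..s} \<Longrightarrow> j \<in> {1..s} \<Longrightarrow> i \<noteq> j \<Longrightarrow> v \<in> W i \<Longrightarrow> v \<in> W j \<Longrightarrow> v = 0"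

text \<open>A nonzero vector common to two of the planes would span a point common to two skew
  lines. This turns skewness into the vector condition \<open>W_Int\<close>, with which all later
  arguments work.\<close>

lemma skew_lines_config:
  assumes "skew_lines L s"
  obtains W where "skew_config L W s"
proof -
  have "\<forall>i\<in>{1..s}. \<exists>W. vec.subspace W \<and> vec.dim W = 2 \<and> L i = {p \<in> proj_points. p \<subseteq> W}"
    using assms unfolding skew_lines_def proj_line_def by blast
  from bchoice[OF this] obtain W where W: "\<forall>i\<in>{1..s}. vec.subspace (W i) \<and> vec.dim (W i) = 2 \<and>
      L i = {p \<in> proj_points. p \<subseteq> W i}"
    by blast
  have "v = 0" if "i \<in> {1..s}" "j \<in> {1..s}" "i \<noteq> j" "v \<in> W i" "v \<in> W j" for i j v
  proof (rule ccontr)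
    assume "v \<noteq> 0"
    then have "vec.span {v} \<in> L i \<inter> L j"
      using that W by (auto simp: span_in_proj_points span_singleton_subset_iff)
    then show False
      using assms that unfolding skew_lines_def skew_def by blast
  qed
  then have "skew_config L W s"
    using W by unfold_locales auto
  then show thesis by (rule that)
qed

context skew_config
begin

lemma span_in_L_iff: "i \<in> {1..s} \<Longrightarrow> v \<noteq> 0 \<Longrightarrow> vec.span {v} \<in> L i \<longleftrightarrow> v \<in> W i"
  by (simp add: L_eq span_in_proj_points span_singleton_subset_iff subspace_W)

lemma in_LE:
  assumes "i \<in> {1..s}" "p \<in> L i"
  obtains v where "v \<in> W i" "v \<noteq> 0" "p = vec.span {v}"
  using assms by (metis (mono_tags, lifting) L_eq mem_Collect_eq proj_pointsE span_singleton_subset_iff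
      subspace_W)

lemma L_Int: "i \<in> {1..s} \<Longrightarrow> j \<in> {1..s} \<Longrightarrow> p \<in> L i \<Longrightarrow> p \<in> L j \<Longrightarrow> i = j"
  by (metis W_Int in_LE span_in_L_iff)

lemma union_linesE:
  assumes "p \<in> union_lines L s"
  obtains i where "i \<in> {1..s}" "p \<in> L i"
  using assms unfolding union_lines_def by blast

lemma union_linesI: "i \<in> {1..s} \<Longrightarrow> p \<in> L i \<Longrightarrow> p \<in> union_lines L s"
  unfolding union_lines_def by blast

lemma proj_line_L: "i \<in> {1..s} \<Longrightarrow> proj_line (L i)"
  unfolding proj_line_def using subspace_W[of i] dim_W[of i] L_eq[of i] by blast

text \<open>Two planes meeting only in 0 have a sum of dimension 2 + 2 = 4, which is the whole
  space.\<close>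

lemma decompose:
  assumes "j \<in> {1..s}" "k \<in> {1..s}" "j \<noteq> k"
  obtains w where "w \<in> W j" "v - w \<in> W k"
proof -
  have "W j \<inter> W k = {0}"
    using W_Int[OF assms] subspace_W assms vec.subspace_0 by blast
  moreover have "vec.dim {0::'a^4} = 0" by simp
  ultimately have "vec.dim {x + y |x y. x \<in> W j \<and> y \<in> W k} = 4"
    using vec.dim_sums_Int[OF subspace_W subspace_W, OF assms(1,2)] dim_W assms by simp
  moreover have "vec.dim (UNIV :: ('a^4) set) = 4"
    by (simp add: card_cart_basis)
  ultimately have "{x + y |x y. x \<in> W j \<and> y \<in> W k} = UNIV"
    using vec.subspace_sums[OF subspace_W subspace_W, OF assms(1,2)]
    by (intro vec.subspace_dim_equal) auto
  then have "v \<in> {x + y |x y. x \<in> W j \<and> y \<in> W k}"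
    by blast
  then show thesis
    using that by auto
qed

lemma decompose_unique:
  assumes "j \<in> {1..s}" "k \<in> {1..s}" "j \<noteq> k"
    and "w \<in> W j" "v - w \<in> W k" "w' \<in> W j" "v - w' \<in> W k"
  shows "w = w'"
proof -
  have "w - w' \<in> W j"
    using assms subspace_W vec.subspace_diff by blast
  moreover have "w - w' \<in> W k"
    using vec.subspace_diff[OF subspace_W assms(7,5)] assms by simp
  ultimately show ?thesis
    using W_Int assms by fastforce
qed

definition proj_along :: "nat \<Rightarrow> nat \<Rightarrow> 'a^4 \<Rightarrow> 'a^4" where
  "proj_along j k v = (THE w. w \<in> W j \<and> v - w \<in> W k)"

lemma proj_along_eq:
  assumes "j \<in> {1..s}" "k \<in> {1..s}" "j \<noteq> k" "w \<in> W j" "v - w \<in> W k"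
  shows "proj_along j k v = w"
  unfolding proj_along_def using decompose_unique assms by blast

lemma proj_along:
  assumes "j \<in> {1..s}" "k \<in> {1..s}" "j \<noteq> k"
  shows "proj_along j k v \<in> W j" "v - proj_along j k v \<in> W k"
  using decompose[OF assms] proj_along_eq[OF assms] by metis+

lemma linear_proj_along:
  assumes "j \<in> {1..s}" "k \<in> {1..s}" "j \<noteq> k"
  shows "Vector_Spaces.linear (*s) (*s) (proj_along j k)"
proof -
  note P = proj_along[OF assms]
  note sub = subspace_W[OF assms(1)] subspace_W[OF assms(2)]
  have "proj_along j k (x + y) = proj_along j k x + proj_along j k y" for x y
  proof (rule proj_along_eq[OF assms])
    show "proj_along j k x + proj_along j k y \<in> W j"
      using P sub vec.subspace_add by blast
    show "x + y - (proj_along j k x + proj_along j k y) \<in> W k"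
      using vec.subspace_add[OF sub(2) P(2)[of x] P(2)[of y]] by (simp add: algebra_simps)
  qed
  moreover have "proj_along j k (c *s x) = c *s proj_along j k x" for c x
  proof (rule proj_along_eq[OF assms])
    show "c *s proj_along j k x \<in> W j"
      using P sub vec.subspace_scale by blast
    show "c *s x - c *s proj_along j k x \<in> W k"
      using vec.subspace_scale[OF sub(2) P(2)[of x], of c] by (simp add: vec.scale_right_diff_distrib)
  qed
  ultimately show ?thesis
    by (simp add: Vector_Spaces.linear_iff vec.vector_space_axioms)
qed

text \<open>A vector projected to 0 lies in \<open>W k\<close>, and \<open>W k\<close> meets
  \<open>W i\<close> only in 0.\<close>

lemma proj_along_nonzero:
  assumes "i \<in> {1..s}" "j \<in> {1..s}" "k \<in> {1..s}" "j \<noteq> k" "i \<noteq> k" "v \<in> W i" "v \<noteq> 0"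
  shows "proj_along j k v \<noteq> 0"
  using proj_along(2)[OF assms(2,3,4), of v] W_Int[OF assms(1,3,5,6)] assms(7) by auto

section \<open>The maps between the lines, expressed by projections\<close>

lemma span_insert_line:
  assumes "k \<in> {1..s}" "p = vec.span {v}"
  shows "x \<in> vec.span (\<Union>(insert p (L k))) \<longleftrightarrow> (\<exists>a. x - a *s v \<in> W k)"
proof -
  have "\<Union>(insert p (L k)) \<subseteq> vec.span (insert v (W k))"
    using assms vec.span_mono[of "{v}" "insert v (W k)"] vec.span_superset[of "insert v (W k)"]
    by (auto simp: L_eq)
  moreover have "insert v (W k) \<subseteq> vec.span (\<Union>(insert p (L k)))"
  proof
    fix x assume "x \<in> insert v (W k)"
    then consider "x = v" | "x = 0" | "x \<in> W k" "x \<noteq> 0" by blast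
    then show "x \<in> vec.span (\<Union>(insert p (L k)))"
    proof cases
      case 1
      then have "x \<in> p"
        using assms by (simp add: vec.span_base)
      then show ?thesis by (auto intro: vec.span_base)
    next
      case 3
      then have "vec.span {x} \<in> L k"
        using assms by (simp add: span_in_L_iff)
      moreover have "x \<in> vec.span {x}"
        by (simp add: vec.span_base)
      ultimately show ?thesis by (blast intro: vec.span_base)
    qed (simp add: vec.span_zero)
  qed
  ultimately have "vec.span (\<Union>(insert p (L k))) = vec.span (insert v (W k))"
    by (meson subset_antisym vec.span_minimal vec.subspace_span)
  moreover have "vec.span (W k) = W k"
    using subspace_W[OF assms(1)] by (simp only: vec.span_eq_iff)
  ultimately show ?thesis
    by (simp only: vec.span_breakdown_eq)
qed

text \<open>A vector \<open>v\<close> and its projection \<open>w\<close> differ by an element of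
  \<open>W k\<close>, so \<open>w\<close> spans a point of the plane through \<open>p\<close> and
  \<open>L k\<close>. It is the only such point on \<open>L j\<close>: a vector of
  \<open>W j\<close> congruent to \<open>a *s v\<close> modulo \<open>W k\<close> must be
  \<open>a *s w\<close>.\<close>

lemma line_map_span:
  assumes "i \<in> {1..s}" "j \<in> {1..s}" "k \<in> {1..s}" "i \<noteq> j" "i \<noteq> k" "j \<noteq> k"
    and "v \<in> W i" "v \<noteq> 0"
  shows "line_map L i j k (vec.span {v}) = vec.span {proj_along j k v}"
proof -
  define w where "w = proj_along j k v"
  have w: "w \<in> W j" "v - w \<in> W k" "w \<noteq> 0"
    unfolding w_def using assms proj_along[OF assms(2,3,6), of v] proj_along_nonzero by auto
  have wk: "w - v \<in> W k"
    using vec.subspace_neg[OF subspace_W w(2)] assms by simp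
  have "(THE q. q \<in> proj_span (insert (vec.span {v}) (L k)) \<inter> L j) = vec.span {w}"
  proof (rule the_equality)
    have "w \<in> vec.span (\<Union>(insert (vec.span {v}) (L k)))"
      unfolding span_insert_line[OF assms(3) refl] using wk by (intro exI[of _ 1]) simp
    then show "vec.span {w} \<in> proj_span (insert (vec.span {v}) (L k)) \<inter> L j"
      using w assms(2)
      by (simp add: proj_span_def span_in_proj_points span_in_L_iff span_singleton_subset_iff del: Union_insert)
  next
    fix q assume q: "q \<in> proj_span (insert (vec.span {v}) (L k)) \<inter> L j"
    then obtain x where x: "x \<in> W j" "x \<noteq> 0" "q = vec.span {x}"
      using in_LE[OF assms(2)] by blast
    then have "x \<in> vec.span (\<Union>(insert (vec.span {v}) (L k)))"
      using q span_singleton_subset_iff[OF vec.subspace_span] by (auto simp only: proj_span_def)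
    then obtain a where a: "x - a *s v \<in> W k"
      using span_insert_line[OF assms(3) refl] by blast
    have "a *s v - x \<in> W k"
      using vec.subspace_neg[OF subspace_W a] assms by simp
    then have "proj_along j k (a *s v) = x"
      using proj_along_eq x assms by blast
    then have "x = a *s w"
      using vec.linear_scale[OF linear_proj_along] assms by (metis w_def)
    \<comment> \<open>The coefficient \<open>a\<close> cannot be 0, because \<open>x\<close> is
      nonzero.\<close>
    then show "q = vec.span {w}"
      using x by (cases "a = 0") (auto simp: span_scale_eq)
  qed
  moreover have "vec.span {v} \<in> L i"
    using assms by (simp add: span_in_L_iff)
  ultimately show ?thesis
    by (simp add: line_map_def w_def)
qed

text \<open>This form allows the image to be read off from any decomposition of \<open>v\<close>
  along \<open>W j\<close> and \<open>W k\<close>.\<close>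

lemma line_map_eqI:
  assumes "i \<in> {1..s}" "j \<in> {1..s}" "k \<in> {1..s}" "i \<noteq> j" "i \<noteq> k" "j \<noteq> k"
    and "v \<in> W i" "v \<noteq> 0" "w \<in> W j" "v - w \<in> W k"
  shows "line_map L i j k (vec.span {v}) = vec.span {w}"
  using line_map_span[OF assms(1-8)] proj_along_eq[OF assms(2,3,6,9,10)] by simp

lemma line_map_in:
  assumes "i \<in> {1..s}" "j \<in> {1..s}" "k \<in> {1..s}" "i \<noteq> j" "i \<noteq> k" "j \<noteq> k" "p \<in> L i"
  shows "line_map L i j k p \<in> L j"
proof -
  obtain v where "v \<in> W i" "v \<noteq> 0" "p = vec.span {v}"
    using assms in_LE by metis
  then show ?thesis
    using assms proj_along proj_along_nonzero by (simp add: line_map_span span_in_L_iff)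
qed

text \<open>The condition that \<open>v - w\<close> lies in \<open>W k\<close> is symmetric in
  \<open>v\<close> and \<open>w\<close> up to a sign, so projecting back from the same line
  \<open>L k\<close> recovers the point.\<close>

lemma line_map_inverse:
  assumes "i \<in> {1..s}" "j \<in> {1..s}" "k \<in> {1..s}" "i \<noteq> j" "i \<noteq> k" "j \<noteq> k" "p \<in> L i"
  shows "line_map L j i k (line_map L i j k p) = p"
proof -
  obtain v where v: "v \<in> W i" "v \<noteq> 0" "p = vec.span {v}"
    using assms in_LE by metis
  define w where "w = proj_along j k v"
  have w: "w \<in> W j" "v - w \<in> W k" "w \<noteq> 0"
    unfolding w_def using assms v proj_along[OF assms(2,3,6), of v] proj_along_nonzero by auto
  have "w - v \<in> W k"
    using vec.subspace_neg[OF subspace_W w(2)] assms by simp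
  then have "line_map L j i k (vec.span {w}) = vec.span {v}"
    using assms v w by (intro line_map_eqI) auto
  then show ?thesis
    using assms v by (simp add: line_map_span w_def)
qed

section \<open>Arrows of the groupoid: inverses, linear lifts and rigidity\<close>

lemma arrow_index: "is_arrow L s i j g \<Longrightarrow> i \<in> {1..s} \<and> j \<in> {1..s}"
  by (induction rule: is_arrow.induct) auto

lemma arrow_extensional: "is_arrow L s i j g \<Longrightarrow> g \<in> extensional (L i)"
  by (induction rule: is_arrow.induct) (auto simp: line_map_def compose_def extensional_def)

lemma arrow_in: "is_arrow L s i j g \<Longrightarrow> p \<in> L i \<Longrightarrow> g p \<in> L j"
  by (induction arbitrary: p rule: is_arrow.induct) (auto simp: line_map_in compose_eq)

text \<open>Inverses are not built into \<open>is_arrow\<close>. They exist because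
  \<open>f_jik\<close> undoes \<open>f_ijk\<close>, and a composite is undone in reverse
  order.\<close>

lemma arrow_inverse:
  assumes "is_arrow L s i j g"
  obtains h where "is_arrow L s j i h" "\<And>p. p \<in> L i \<Longrightarrow> h (g p) = p"
proof -
  have "\<exists>h. is_arrow L s j i h \<and> (\<forall>p\<in>L i. h (g p) = p)"
    using assms
  proof (induction rule: is_arrow.induct)
    case (identity i)
    then show ?case
      by (intro exI[of _ "\<lambda>p\<in>L i. p"] conjI is_arrow.identity) simp_all
  next
    case (generator i j k)
    then show ?case
      by (intro exI[of _ "line_map L j i k"]) (auto intro!: is_arrow.generator simp: line_map_inverse)
  next
    case (composition i j g k h)
    then obtain g' h' where "is_arrow L s j i g'" "\<forall>p\<in>L i. g' (g p) = p"
      "is_arrow L s k j h'" "\<forall>p\<in>L j. h' (h p) = p"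
      by blast
    then show ?case
      using composition.hyps
      by (intro exI[of _ "compose (L k) g' h'"])
        (auto intro: is_arrow.composition simp: compose_eq arrow_in)
  qed
  then show thesis using that by blast
qed

text \<open>Generators lift to projections, and lifts compose. The nonvanishing clause makes the
  lift injective on \<open>W i\<close> and lets the induction pass through composition.\<close>

lemma arrow_linear:
  assumes "is_arrow L s i j g"
  obtains M where "Vector_Spaces.linear (*s) (*s) M"
    "\<And>v. v \<in> W i \<Longrightarrow> v \<noteq> 0 \<Longrightarrow> M v \<in> W j \<and> M v \<noteq> 0 \<and> g (vec.span {v}) = vec.span {M v}"
proof -
  have "\<exists>M. Vector_Spaces.linear (*s) (*s) M \<and> (\<forall>v\<in>W i. v \<noteq> 0 \<longrightarrow>
      M v \<in> W j \<and> M v \<noteq> 0 \<and> g (vec.span {v}) = vec.span {M v})"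
    using assms
  proof (induction rule: is_arrow.induct)
    case (identity i)
    then show ?case
      by (intro exI[of _ "\<lambda>v. v"]) (auto simp: span_in_L_iff vec.linear_ident)
  next
    case (generator i j k)
    then show ?case
      by (intro exI[of _ "proj_along j k"])
        (simp add: linear_proj_along proj_along proj_along_nonzero line_map_span)
  next
    case (composition i j g k h)
    from composition.IH(1) obtain M where M: "Vector_Spaces.linear (*s) (*s) M"
      "\<forall>v\<in>W i. v \<noteq> 0 \<longrightarrow> M v \<in> W j \<and> M v \<noteq> 0 \<and> g (vec.span {v}) = vec.span {M v}"
      by (elim exE conjE)
    from composition.IH(2) obtain N where N: "Vector_Spaces.linear (*s) (*s) N"
      "\<forall>v\<in>W j. v \<noteq> 0 \<longrightarrow> N v \<in> W k \<and> N v \<noteq> 0 \<and> h (vec.span {v}) = vec.span {N v}"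
      by (elim exE conjE)
    have "i \<in> {1..s}"
      using composition.hyps arrow_index by blast
    then show ?case
      using M N by (intro exI[of _ "N \<circ> M"] conjI Vector_Spaces.linear_compose[OF M(1) N(1)])
        (simp add: compose_eq span_in_L_iff)
  qed
  then show thesis using that by blast
qed

text \<open>A projective map of a line is determined by its values on a frame of three points. At
  \<open>v\<close>, \<open>w\<close> and \<open>v + w\<close> the two lifts agree up to scalars
  \<open>a\<close>, \<open>b\<close>, \<open>c\<close>; additivity forces these to coincide, so the
  lifts are proportional on the whole plane.\<close>

lemma arrow_eqI:
  assumes g: "is_arrow L s i j g" and h: "is_arrow L s i j h"
    and vw: "v \<in> W i" "w \<in> W i" "v \<noteq> 0" "w \<notin> vec.span {v}"
    and eq: "\<And>u. u \<in> {v, w, v + w} \<Longrightarrow> g (vec.span {u}) = h (vec.span {u})"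
  shows "g = h"
proof (rule extensionalityI)
  have i: "i \<in> {1..s}"
    using g arrow_index by blast
  note sub = subspace_W[OF i]
  obtain M where M: "Vector_Spaces.linear (*s) (*s) M"
    "\<And>v. v \<in> W i \<Longrightarrow> v \<noteq> 0 \<Longrightarrow> M v \<in> W j \<and> M v \<noteq> 0 \<and> g (vec.span {v}) = vec.span {M v}"
    using arrow_linear[OF g] by blast
  obtain N where N: "Vector_Spaces.linear (*s) (*s) N"
    "\<And>v. v \<in> W i \<Longrightarrow> v \<noteq> 0 \<Longrightarrow> N v \<in> W j \<and> N v \<noteq> 0 \<and> h (vec.span {v}) = vec.span {N v}"
    using arrow_linear[OF h] by blast
  note lin = vec.linear_add[OF M(1)] vec.linear_scale[OF M(1)]
    vec.linear_add[OF N(1)] vec.linear_scale[OF N(1)]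
  have indep: "a = 0 \<and> b = 0" if "a *s v + b *s w = 0" for a b
  proof -
    have "b = 0"
    proof (rule ccontr)
      assume "b \<noteq> 0"
      have "b *s w = (- a) *s v"
        using that by (simp add: add_eq_0_iff)
      then have "inverse b *s (b *s w) = inverse b *s ((- a) *s v)"
        by simp
      then have "w = (inverse b * (- a)) *s v"
        using \<open>b \<noteq> 0\<close> by simp
      then show False
        using vw span_singleton_iff by blast
    qed
    then show ?thesis
      using that vw by simp
  qed
  have nz: "v \<noteq> 0" "w \<noteq> 0" "v + w \<noteq> 0"
    using vw indep[of 1 1] by (auto simp: vec.span_zero)
  have inW: "v \<in> W i" "w \<in> W i" "v + w \<in> W i"
    using vw sub vec.subspace_add by auto
  have "\<exists>c. M u = c *s N u" if "u \<in> {v, w, v + w}" for u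
    using eq[OF that] M(2)[of u] N(2)[of u] nz inW that by (metis insertE singletonD span_eqE)
  then obtain a b c where abc: "M v = a *s N v" "M w = b *s N w" "M (v + w) = c *s N (v + w)"
    by (meson insertI1 insertI2)
  \<comment> \<open>Expanding \<open>M (v + w)\<close> in two ways gives a vector of
    \<open>W i\<close> killed by \<open>N\<close>. Since \<open>N\<close> is injective on
    \<open>W i\<close>, both coefficients vanish.\<close>
  have "N ((a - c) *s v + (b - c) *s w) = (a *s N v + b *s N w) - c *s (N v + N w)"
    by (simp only: lin) (simp add: vec.scale_left_diff_distrib vec.scale_right_distrib)
  also have "\<dots> = 0"
    using abc by (simp only: lin) simp
  finally have "N ((a - c) *s v + (b - c) *s w) = 0" .
  moreover have "(a - c) *s v + (b - c) *s w \<in> W i"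
    using inW sub by (simp add: vec.subspace_add vec.subspace_scale)
  ultimately have "(a - c) *s v + (b - c) *s w = 0"
    using N(2) by blast
  from indep[OF this] have "a = c" "b = c"
    by simp_all
  have MN: "M x = c *s N x" if "x \<in> W i" for x
  proof -
    have "x \<in> vec.span {w, v}"
      using plane_eq_span_pair[OF sub dim_W[OF i]] vw that by blast
    then obtain d e where "x = d *s w + e *s v"
      by (auto simp: span_pair_iff)
    then show ?thesis
      using abc \<open>a = c\<close> \<open>b = c\<close> by (simp add: lin vec.scale_right_distrib mult.commute)
  qed
  then have "c \<noteq> 0"
    using M(2)[OF vw(1,3)] vw(1) by fastforce
  fix p assume "p \<in> L i"
  then obtain x where "x \<in> W i" "x \<noteq> 0" "p = vec.span {x}"
    using in_LE[OF i] by blast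
  then show "g p = h p"
    using M(2) N(2) MN \<open>c \<noteq> 0\<close> by (simp add: span_scale_eq)
qed (use arrow_extensional g h in auto)

section \<open>Orbits and sets closed under the generators\<close>

lemma orbit_eq:
  assumes "i \<in> {1..s}" "p \<in> L i"
  shows "orbit L s p = {g p |g j. is_arrow L s i j g}"
proof -
  have "{i \<in> {1..s}. p \<in> L i} = {i}"
    using assms L_Int by blast
  then have eq: "orbit L s p = (\<Union>j\<in>{1..s}. {g p |g. is_arrow L s i j g})"
    by (simp add: orbit_def Hom_def)
  show ?thesis
  proof (intro subset_antisym subsetI)
    fix q assume "q \<in> {g p |g j. is_arrow L s i j g}"
    then obtain g j where g: "is_arrow L s i j g" "q = g p"
      by blast
    moreover from g(1) have "j \<in> {1..s}"
      using arrow_index by blast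
    ultimately show "q \<in> orbit L s p"
      unfolding eq by blast
  qed (auto simp: eq)
qed

lemma self_in_orbit:
  assumes "p \<in> union_lines L s"
  shows "p \<in> orbit L s p"
proof -
  obtain i where i: "i \<in> {1..s}" "p \<in> L i"
    using assms union_linesE by blast
  then have "is_arrow L s i i (\<lambda>p\<in>L i. p)" "p = (\<lambda>p\<in>L i. p) p"
    by (auto intro: is_arrow.identity simp del: atLeastAtMost_iff)
  then show ?thesis
    unfolding orbit_eq[OF i] by blast
qed

text \<open>The common middle term for (a) and (b). Only generators are mentioned, since each of
  them corresponds to a single transversal; closure under all arrows follows by induction.\<close>

definition generator_closed :: "'a ppoint set \<Rightarrow> bool" where
  "generator_closed Z \<longleftrightarrow> (\<forall>i\<in>{1..s}. \<forall>j\<in>{1..s}. \<forall>k\<in>{1..s}. i \<noteq> j \<and> i \<noteq> k \<and> j \<noteq> k \<longrightarrow>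
     line_map L i j k ` (Z \<inter> L i) \<subseteq> Z)"

lemma generator_closed_arrow:
  assumes "generator_closed Z" "is_arrow L s i j g" "p \<in> Z" "p \<in> L i"
  shows "g p \<in> Z"
  using assms(2,3,4)
proof (induction arbitrary: p rule: is_arrow.induct)
  case (generator i j k)
  then show ?case
    using assms(1) unfolding generator_closed_def by blast
qed (auto simp: compose_eq arrow_in)

lemma generator_closed_orbit:
  assumes "p \<in> union_lines L s"
  shows "generator_closed (orbit L s p)"
  unfolding generator_closed_def
proof (intro ballI impI subsetI)
  fix i j k q assume ijk: "i \<in> {1..s}" "j \<in> {1..s}" "k \<in> {1..s}" "i \<noteq> j \<and> i \<noteq> k \<and> j \<noteq> k"
    and "q \<in> line_map L i j k ` (orbit L s p \<inter> L i)"
  then obtain r where r: "r \<in> orbit L s p" "r \<in> L i" "q = line_map L i j k r"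
    by blast
  obtain m where m: "m \<in> {1..s}" "p \<in> L m"
    using assms by (auto simp: union_lines_def)
  then obtain g l where g: "is_arrow L s m l g" "r = g p"
    using r by (auto simp: orbit_eq)
  then have "l \<in> {1..s}" "r \<in> L l"
    using arrow_index arrow_in m by blast+
  \<comment> \<open>The lines are disjoint, so the arrow reaching \<open>r\<close> ends exactly
    where the generator starts, and the two compose.\<close>
  then have "l = i"
    using L_Int r ijk by blast
  moreover have "is_arrow L s i j (line_map L i j k)"
    using ijk by (intro is_arrow.generator) blast+
  ultimately have "is_arrow L s m j (compose (L m) (line_map L i j k) g)"
    using g by (blast intro: is_arrow.composition)
  moreover have "q = compose (L m) (line_map L i j k) g p"
    using m r g by (simp add: compose_eq)
  ultimately show "q \<in> orbit L s p"
    using m by (auto simp: orbit_eq)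
qed

text \<open>Orbits are closed under generators, and closure passes to unions. Conversely, a closed
  set contains the orbit of each of its points, hence is the union of these orbits.\<close>

lemma union_of_orbits_iff:
  assumes "Z \<subseteq> union_lines L s"
  shows "union_of_orbits L s Z \<longleftrightarrow> generator_closed Z"
proof
  assume "union_of_orbits L s Z"
  then obtain P where P: "P \<subseteq> union_lines L s" "Z = (\<Union>p\<in>P. orbit L s p)"
    by (auto simp: union_of_orbits_def)
  have closed: "generator_closed (orbit L s p)" if "p \<in> P" for p
    using P(1) that generator_closed_orbit by blast
  show "generator_closed Z"
    unfolding generator_closed_def
  proof (intro ballI impI subsetI)
    fix i j k q assume ijk: "i \<in> {1..s}" "j \<in> {1..s}" "k \<in> {1..s}" "i \<noteq> j \<and> i \<noteq> k \<and> j \<noteq> k"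
      and "q \<in> line_map L i j k ` (Z \<inter> L i)"
    then obtain p where p: "p \<in> P" "q \<in> line_map L i j k ` (orbit L s p \<inter> L i)"
      using P(2) by blast
    then have "q \<in> orbit L s p"
      using closed[OF p(1)] ijk unfolding generator_closed_def by blast
    then show "q \<in> Z"
      using P(2) p(1) by blast
  qed
next
  assume Z: "generator_closed Z"
  have "orbit L s p \<subseteq> Z" if p: "p \<in> Z" for p
  proof -
    obtain i where "i \<in> {1..s}" "p \<in> L i"
      using assms p by (meson subsetD union_linesE)
    then show ?thesis
      using generator_closed_arrow[OF Z] p by (auto simp: orbit_eq)
  qed
  then have "Z = (\<Union>p\<in>Z. orbit L s p)"
    using self_in_orbit assms by blast
  then show "union_of_orbits L s Z"
    using assms unfolding union_of_orbits_def by blast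
qed

section \<open>Transversals and collinear completeness\<close>

lemma transversal_through_line_map:
  assumes "i \<in> {1..s}" "j \<in> {1..s}" "k \<in> {1..s}" "i \<noteq> j" "i \<noteq> k" "j \<noteq> k" "p \<in> L i"
  obtains T where "transversal3 L s T" "p \<in> T" "line_map L i j k p \<in> T"
proof -
  obtain v where v: "v \<in> W i" "v \<noteq> 0" "p = vec.span {v}"
    using assms in_LE by metis
  define w where "w = proj_along j k v"
  have w: "w \<in> W j" "v - w \<in> W k" "w \<noteq> 0"
    unfolding w_def using assms v proj_along[OF assms(2,3,6), of v] proj_along_nonzero by auto
  have "v \<notin> W j"
    using W_Int assms v by blast
  then have u: "v - w \<noteq> 0" and indep: "v \<notin> vec.span {w}"
    using w assms subspace_W span_singleton_subset_iff by auto
  \<comment> \<open>The line joining \<open>p\<close> to its image. The third line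
    \<open>L k\<close> is met in the point spanned by \<open>v - w\<close>.\<close>
  define T where "T = {q \<in> proj_points. q \<subseteq> vec.span {v, w}}"
  have T: "proj_line T"
    unfolding proj_line_def T_def using dim_span_pair[OF w(3) indep] by blast
  have "v \<in> vec.span {v, w}" "w \<in> vec.span {v, w}"
    by (simp_all add: vec.span_base)
  moreover from this have "v - w \<in> vec.span {v, w}"
    by (rule vec.span_diff)
  ultimately have in_T: "vec.span {v} \<in> T" "vec.span {w} \<in> T" "vec.span {v - w} \<in> T"
    using v w u by (auto simp: T_def span_in_proj_points span_singleton_subset_iff)
  have in_L: "vec.span {v} \<in> L i" "vec.span {w} \<in> L j" "vec.span {v - w} \<in> L k"
    using v w u assms span_in_L_iff by auto
  \<comment> \<open>\<open>T\<close> contains points of different lines of the family, so it cannot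
    be one of these disjoint lines.\<close>
  have "T \<noteq> L m" if "m \<in> {1..s}" for m
    using that in_T in_L L_Int assms by metis
  moreover have "{i, j, k} \<subseteq> {i \<in> {1..s}. T \<inter> L i \<noteq> {}}"
    using in_T in_L assms by blast
  then have "card {i \<in> {1..s}. T \<inter> L i \<noteq> {}} \<ge> card {i, j, k}"
    by (intro card_mono) auto
  then have "card {i \<in> {1..s}. T \<inter> L i \<noteq> {}} \<ge> 3"
    using assms by simp
  ultimately have "transversal3 L s T"
    using T by (simp add: transversal3_def)
  then show thesis
    using that in_T v assms line_map_span by (metis w_def)
qed

text \<open>The points \<open>q\<close> and \<open>r\<close> span \<open>T\<close>, so
  \<open>v = a *s w + b *s u\<close> with \<open>b *s u\<close> in \<open>W k\<close>. Projecting
  along \<open>W k\<close> leaves \<open>a *s w\<close>, where \<open>a\<close> is nonzero because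
  \<open>L i\<close> and \<open>L k\<close> are skew.\<close>

lemma line_map_on_transversal:
  assumes "i \<in> {1..s}" "j \<in> {1..s}" "k \<in> {1..s}" "i \<noteq> j" "i \<noteq> k" "j \<noteq> k"
    and "proj_line T" "p \<in> T" "p \<in> L i" "q \<in> T" "q \<in> L j" "r \<in> T" "r \<in> L k"
  shows "line_map L i j k p = q"
proof -
  obtain A where A: "vec.subspace A" "vec.dim A = 2" "T = {p \<in> proj_points. p \<subseteq> A}"
    using assms unfolding proj_line_def by blast
  obtain v where v: "v \<in> W i" "v \<noteq> 0" "p = vec.span {v}"
    using assms in_LE by metis
  obtain w where w: "w \<in> W j" "w \<noteq> 0" "q = vec.span {w}"
    using assms in_LE by metis
  obtain u where u: "u \<in> W k" "u \<noteq> 0" "r = vec.span {u}"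
    using assms in_LE by metis
  have inA: "v \<in> A" "w \<in> A" "u \<in> A"
    using A u v w assms by (auto simp: span_singleton_subset_iff)
  have "w \<notin> vec.span {u}"
    using W_Int[OF assms(2,3,6)] w u assms subspace_W span_singleton_subset_iff by blast
  then have "A = vec.span {w, u}"
    using plane_eq_span_pair[OF A(1,2)] inA u by blast
  then obtain a b where ab: "v = a *s w + b *s u"
    using inA span_pair_iff by blast
  have bu: "b *s u \<in> W k"
    using u subspace_W assms vec.subspace_scale by blast
  have "a \<noteq> 0"
  proof
    assume "a = 0"
    with ab bu have "v \<in> W k" by simp
    then show False using W_Int assms v by blast
  qed
  have "line_map L i j k (vec.span {v}) = vec.span {a *s w}"
    using v w ab bu assms subspace_W vec.subspace_scale by (intro line_map_eqI) auto
  then show ?thesis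
    using v w \<open>a \<noteq> 0\<close> by (simp add: span_scale_eq)
qed

text \<open>A generator moves a point along a transversal. Conversely, two points of a transversal
  on different lines are related by a generator that projects from any further line met by
  it.\<close>

lemma collinearly_complete_iff:
  assumes "Z \<noteq> {}" "Z \<subseteq> union_lines L s"
  shows "collinearly_complete L s Z \<longleftrightarrow> generator_closed Z"
proof
  assume Z: "collinearly_complete L s Z"
  show "generator_closed Z"
    unfolding generator_closed_def
  proof (intro ballI impI subsetI)
    fix i j k q assume ijk: "i \<in> {1..s}" "j \<in> {1..s}" "k \<in> {1..s}" "i \<noteq> j \<and> i \<noteq> k \<and> j \<noteq> k"
      and "q \<in> line_map L i j k ` (Z \<inter> L i)"
    then obtain p where p: "p \<in> Z" "p \<in> L i" "q = line_map L i j k p"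
      by blast
    then obtain T where "transversal3 L s T" "p \<in> T" "q \<in> T"
      using ijk by (metis transversal_through_line_map)
    moreover have "q \<in> union_lines L s"
      using line_map_in[of i j k p] ijk p union_linesI by blast
    ultimately show "q \<in> Z"
      using Z p unfolding collinearly_complete_def by blast
  qed
next
  assume Z: "generator_closed Z"
  have "q \<in> Z" if T: "transversal3 L s T" and pq: "p \<in> T" "p \<in> Z" "q \<in> T" "q \<in> union_lines L s" for T p q
  proof -
    obtain i j where ij: "i \<in> {1..s}" "p \<in> L i" "j \<in> {1..s}" "q \<in> L j"
      using pq assms by (meson subsetD union_linesE)
    show ?thesis
    proof (cases "i = j")
      case True
      \<comment> \<open>Otherwise \<open>T\<close> would share two points with \<open>L i\<close>
        and equal it, which a transversal must not.\<close>
      then have "p = q"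
        using proj_line_eqI[of T "L i" p q] proj_line_L ij T pq unfolding transversal3_def by blast
      then show ?thesis using pq by simp
    next
      case False
      define I where "I = {i \<in> {1..s}. T \<inter> L i \<noteq> {}}"
      \<comment> \<open>At least three lines are met, so one besides \<open>L i\<close> and
        \<open>L j\<close> is available to project from.\<close>
      have "\<not> I \<subseteq> {i, j}"
      proof
        assume "I \<subseteq> {i, j}"
        then have "card I \<le> card {i, j}"
          by (intro card_mono) auto
        then show False
          using T False by (simp add: transversal3_def I_def)
      qed
      then obtain k r where k: "k \<in> {1..s}" "k \<noteq> i" "k \<noteq> j" "r \<in> T" "r \<in> L k"
        by (auto simp: I_def)
      then have "line_map L i j k p = q"
        using ij T pq False by (intro line_map_on_transversal[of i j k T p q r]) (auto simp: transversal3_def)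
      then show ?thesis
        using generator_closed_arrow[OF Z is_arrow.generator] pq ij k False by metis
    qed
  qed
  then show "collinearly_complete L s Z"
    using assms unfolding collinearly_complete_def by blast
qed

section \<open>Cardinalities on the lines and finiteness of the vertex groups\<close>

lemma generator_closed_image:
  assumes "generator_closed Z"
    and "j \<in> {1..s}" "k \<in> {1..s}" "l \<in> {1..s}" "j \<noteq> k" "j \<noteq> l" "k \<noteq> l"
  shows "bij_betw (line_map L j k l) (Z \<inter> L j) (Z \<inter> L k)"
proof (rule bij_betw_byWitness[where f' = "line_map L k j l"])
  \<comment> \<open>Stated for arbitrary \<open>a\<close> and \<open>b\<close> because it serves
    both directions: the inverse map is itself a generator and so also preserves
    \<open>Z\<close>.\<close>
  have sub: "line_map L a b l ` (Z \<inter> L a) \<subseteq> Z \<inter> L b"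
    if ab: "a \<in> {1..s}" "b \<in> {1..s}" "a \<noteq> b" "a \<noteq> l" "b \<noteq> l" for a b
  proof (rule image_subsetI)
    fix p assume "p \<in> Z \<inter> L a"
    then show "line_map L a b l p \<in> Z \<inter> L b"
      using generator_closed_arrow[OF assms(1) is_arrow.generator, OF ab(1,2) assms(4) ab(3,4,5)]
        line_map_in[OF ab(1,2) assms(4) ab(3,4,5)] by blast
  qed
  show "line_map L j k l ` (Z \<inter> L j) \<subseteq> Z \<inter> L k" "line_map L k j l ` (Z \<inter> L k) \<subseteq> Z \<inter> L j"
    using sub assms by blast+
qed (use assms line_map_inverse in auto)

text \<open>Supplies the line to project from when only two indices are given; this makes the
  groupoid connected.\<close>

lemma third_index:
  assumes "s \<ge> 3"
  obtains l where "l \<in> {1..s}" "l \<noteq> j" "l \<noteq> k"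
proof -
  have "\<not> {1..s} \<subseteq> {j, k}"
  proof
    assume "{1..s} \<subseteq> {j, k}"
    then have "card {1..s} \<le> card {j, k}"
      by (intro card_mono) auto
    also have "card {j, k} \<le> 2"
      by (simp add: card_insert_if)
    finally show False using assms by simp
  qed
  then show thesis using that by blast
qed

lemma arrow_exists:
  assumes "s \<ge> 3" "i \<in> {1..s}" "j \<in> {1..s}"
  obtains g where "is_arrow L s i j g"
proof (cases "i = j")
  case True
  then show thesis
    using that is_arrow.identity[OF assms(2)] by blast
next
  case False
  obtain l where "l \<in> {1..s}" "l \<noteq> i" "l \<noteq> j"
    using third_index[OF assms(1)] by blast
  then show thesis
    using that is_arrow.generator[OF assms(2,3)] False by blast
qed

text \<open>Fixed arrows from \<open>L m\<close> to \<open>L i\<close> and from \<open>L j\<close>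
  to \<open>L m\<close> turn an arrow from \<open>L i\<close> to \<open>L j\<close> into an element
  of the vertex group at \<open>m\<close>. Invertibility of the fixed arrows makes this assignment
  injective.\<close>

lemma finite_Hom:
  assumes "s \<ge> 3" "m \<in> {1..s}" "finite (vertex_group L s m)" "i \<in> {1..s}" "j \<in> {1..s}"
  shows "finite (Hom L s i j)"
proof -
  obtain a where a: "is_arrow L s m i a"
    using arrow_exists assms by blast
  obtain a' where a': "is_arrow L s i m a'" "\<And>p. p \<in> L m \<Longrightarrow> a' (a p) = p"
    using arrow_inverse[OF a] by blast
  \<comment> \<open>\<open>arrow_inverse\<close> gives only a left inverse. Inverting a second time
    yields an arrow \<open>a''\<close> that is visibly onto \<open>L i\<close>, as every
    \<open>p\<close> there equals \<open>a'' (a' p)\<close>.\<close>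
  obtain a'' where a'': "is_arrow L s m i a''" "\<And>p. p \<in> L i \<Longrightarrow> a'' (a' p) = p"
    using arrow_inverse[OF a'(1)] by blast
  obtain b where b: "is_arrow L s j m b"
    using arrow_exists assms by blast
  obtain b' where b': "is_arrow L s m j b'" "\<And>p. p \<in> L j \<Longrightarrow> b' (b p) = p"
    using arrow_inverse[OF b] by blast
  define F where "F g = compose (L m) b (compose (L m) g a'')" for g
  have "F ` Hom L s i j \<subseteq> vertex_group L s m"
    using a'' b by (auto simp: F_def vertex_group_def Hom_def intro: is_arrow.composition)
  moreover have "inj_on F (Hom L s i j)"
  proof (rule inj_onI)
    fix g h assume gh: "g \<in> Hom L s i j" "h \<in> Hom L s i j" "F g = F h"
    show "g = h"
    proof (rule extensionalityI)
      show "g \<in> extensional (L i)" "h \<in> extensional (L i)"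
        using gh arrow_extensional by (auto simp: Hom_def)
      fix p assume p: "p \<in> L i"
      have "F g (a' p) = b (g p)" "F h (a' p) = b (h p)"
        using p a' a'' arrow_in by (auto simp: F_def compose_eq)
      then have "b' (b (g p)) = b' (b (h p))"
        using gh by simp
      then show "g p = h p"
        using b' gh p arrow_in by (auto simp: Hom_def)
    qed
  qed
  ultimately show ?thesis
    using assms(3) finite_subset inj_on_finite by blast
qed

lemma finite_orbit:
  assumes "s \<ge> 3" "m \<in> {1..s}" "finite (vertex_group L s m)"
  shows "finite (orbit L s p)"
proof -
  have "{g p |g. g \<in> Hom L s i j} = (\<lambda>g. g p) ` Hom L s i j" for i j
    by blast
  then show ?thesis
    unfolding orbit_def using finite_Hom[OF assms] by simp
qed

text \<open>Restriction to a frame of three points of \<open>L i\<close> is injective on the vertex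
  group by \<open>arrow_eqI\<close>, and its values lie in a product of three finite orbits.\<close>

lemma finite_vertex_group:
  assumes "\<forall>p\<in>union_lines L s. finite (orbit L s p)" and i: "i \<in> {1..s}"
  shows "finite (vertex_group L s i)"
proof -
  obtain v w where vw: "v \<in> W i" "w \<in> W i" "v \<noteq> 0" "w \<notin> vec.span {v}"
    using plane_basisE[OF subspace_W dim_W] i by metis
  define X where "X = (\<lambda>u. vec.span {u}) ` {v, w, v + w}"
  \<comment> \<open>If \<open>v + w\<close> were 0, then \<open>w\<close> would be
    \<open>- v\<close> and lie in the span of \<open>v\<close>.\<close>
  have nz: "w \<noteq> 0" "v + w \<noteq> 0"
    using vw span_singleton_iff[of w v] by (auto simp: vec.span_zero add_eq_0_iff)
       (metis add_eq_0_iff vector_smult_lid vec.scale_minus_left)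
  have X: "X \<subseteq> L i"
    using vw nz i subspace_W vec.subspace_add by (auto simp: X_def span_in_L_iff)
  have fin: "finite (PiE X (orbit L s))"
    using X i assms by (intro finite_PiE) (auto simp: X_def union_lines_def)
  have "(\<lambda>g. restrict g X) ` vertex_group L s i \<subseteq> PiE X (orbit L s)"
  proof (rule image_subsetI)
    fix g assume g: "g \<in> vertex_group L s i"
    have "g p \<in> orbit L s p" if "p \<in> X" for p
      using g orbit_eq[OF i, of p] X that unfolding vertex_group_def Hom_def by blast
    then show "restrict g X \<in> PiE X (orbit L s)"
      by (simp add: restrict_PiE_iff)
  qed
  moreover have "inj_on (\<lambda>g. restrict g X) (vertex_group L s i)"
  proof (rule inj_onI)
    fix g h assume gh: "g \<in> vertex_group L s i" "h \<in> vertex_group L s i" "restrict g X = restrict h X"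
    then have "g p = h p" if "p \<in> X" for p
      using that by (metis restrict_apply')
    then show "g = h"
      using gh vw by (intro arrow_eqI[of i i g h v w]) (auto simp: vertex_group_def Hom_def X_def)
  qed
  ultimately show ?thesis
    by (intro inj_on_finite[OF _ _ fin])
qed

end

theorem proposition2p1p11:
  fixes L :: "nat \<Rightarrow> 'a::field ppoint set" and s :: nat and Z :: "'a ppoint set"
  assumes "s \<ge> 3"
    and "skew_lines L s"
    and "Z \<noteq> {}"
    and "Z \<subseteq> union_lines L s"
  shows "(collinearly_complete L s Z \<longleftrightarrow> union_of_orbits L s Z) \<and>
    (\<forall>p\<in>union_lines L s. \<forall>j\<in>{1..s}. \<forall>k\<in>{1..s}. \<forall>l\<in>{1..s}.
        j \<noteq> k \<and> j \<noteq> l \<and> k \<noteq> l \<longrightarrow>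
          line_map L j k l ` orbit_on L s p j = orbit_on L s p k \<and>
          orbit_on L s p j \<approx> orbit_on L s p k) \<and>
    ((\<forall>p\<in>union_lines L s. finite (orbit L s p)) \<longleftrightarrow>
        (\<exists>i\<in>{1..s}. finite (vertex_group L s i))) \<and>
    ((\<forall>p\<in>union_lines L s. finite (orbit L s p)) \<longleftrightarrow>
        (\<forall>i\<in>{1..s}. finite (vertex_group L s i))) \<and>
    (collinearly_complete L s Z \<longrightarrow>
        (\<forall>j k. 1 \<le> j \<and> j < k \<and> k \<le> s \<longrightarrow> Z \<inter> L j \<approx> Z \<inter> L k))"
proof -
  obtain W where "skew_config L W s"
    using skew_lines_config assms by blast
  then interpret skew_config L W s .
  have complete_iff: "collinearly_complete L s Z \<longleftrightarrow> generator_closed Z"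
    using collinearly_complete_iff assms by blast
  then have "collinearly_complete L s Z \<longleftrightarrow> union_of_orbits L s Z"
    using union_of_orbits_iff assms by simp
  moreover have "\<forall>p\<in>union_lines L s. \<forall>j\<in>{1..s}. \<forall>k\<in>{1..s}. \<forall>l\<in>{1..s}.
      j \<noteq> k \<and> j \<noteq> l \<and> k \<noteq> l \<longrightarrow>
        line_map L j k l ` orbit_on L s p j = orbit_on L s p k \<and>
        orbit_on L s p j \<approx> orbit_on L s p k"
  proof (intro ballI impI)
    fix p j k l
    assume "p \<in> union_lines L s" "j \<in> {1..s}" "k \<in> {1..s}" "l \<in> {1..s}"
      and "j \<noteq> k \<and> j \<noteq> l \<and> k \<noteq> l"
    then have "bij_betw (line_map L j k l) (orbit_on L s p j) (orbit_on L s p k)"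
      unfolding orbit_on_def by (intro generator_closed_image generator_closed_orbit) simp_all
    then show "line_map L j k l ` orbit_on L s p j = orbit_on L s p k \<and>
        orbit_on L s p j \<approx> orbit_on L s p k"
      unfolding eqpoll_def using bij_betw_imp_surj_on by blast
  qed
  \<comment> \<open>The index set is nonempty, which closes the cycle: finite orbits make every
    vertex group finite, hence some vertex group, and one finite vertex group makes all orbits
    finite.\<close>
  moreover have "1 \<in> {1..s}"
    using assms by simp
  then have "(\<forall>p\<in>union_lines L s. finite (orbit L s p)) \<longleftrightarrow> (\<exists>i\<in>{1..s}. finite (vertex_group L s i))"
    "(\<forall>p\<in>union_lines L s. finite (orbit L s p)) \<longleftrightarrow> (\<forall>i\<in>{1..s}. finite (vertex_group L s i))"
    using finite_orbit finite_vertex_group assms(1) by blast+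
  moreover have "collinearly_complete L s Z \<longrightarrow>
      (\<forall>j k. 1 \<le> j \<and> j < k \<and> k \<le> s \<longrightarrow> Z \<inter> L j \<approx> Z \<inter> L k)"
  proof (intro impI allI)
    fix j k assume "collinearly_complete L s Z" and jk: "1 \<le> j \<and> j < k \<and> k \<le> s"
    then have "generator_closed Z"
      using complete_iff by simp
    moreover obtain l where "l \<in> {1..s}" "l \<noteq> j" "l \<noteq> k"
      using third_index assms by blast
    ultimately have "bij_betw (line_map L j k l) (Z \<inter> L j) (Z \<inter> L k)"
      using jk by (intro generator_closed_image) auto
    then show "Z \<inter> L j \<approx> Z \<inter> L k"
      unfolding eqpoll_def by blast
  qed
  ultimately show ?thesis
    by (intro conjI)
qed

end
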